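(* Let $\{A_n\}_{n\ge0}$ be a sequence and $n$ a nonnegative integer. If $\{A_n\}$ is an even sequence and $n$ is odd, or if $\{A_n\}$ is an odd sequence and $n$ is even, then $$\sum_{k=0}^n\binom nk\binom{n+k}{k}(-1)^kA_k=0.$$
   Context: A sequence $\{a_n\}_{n\ge0}$ of real (or complex) numbers is called an even sequence if $\sum_{k=0}^n\binom nk(-1)^ka_k=a_n$ for all $n=0,1,2,\ldots$, and an odd sequence if $\sum_{k=0}^n\binom nk(-1)^ka_k=-a_n$ for all $n=0,1,2,\ldots$. *)

theory Defs
  imports Complex_Main
begin

(* The class real_normed_field has both real and complex as instances. *)

definition even_sequence :: "(nat \<Rightarrow> 'a::real_normed_field) \<Rightarrow> bool" where
  "even_sequence a \<longleftrightarrow> (\<forall>n. (\<Sum>k=0..n. of_nat (n choose k) * (-1) ^ k * a k) = a n)"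

definition odd_sequence :: "(nat \<Rightarrow> 'a::real_normed_field) \<Rightarrow> bool" where
  "odd_sequence a \<longleftrightarrow> (\<forall>n. (\<Sum>k=0..n. of_nat (n choose k) * (-1) ^ k * a k) = - a n)"

end

(* The matrix with entries (-1)^k (n choose k) (n+k choose k) is, up to the sign (-1)^n, fixed by the
   binomial transform: sum_k (-1)^k (n choose k) (n+k choose k) (k choose j)
   = (-1)^n (n choose j) (n+j choose j), an iterated finite difference of a binomial coefficient.
   Replacing A_k by plus or minus its binomial transform and exchanging the sums therefore shows
   that the sum in question equals its own negative. *)
theory Submission
  imports Defs
begin

text \<open>Pascal's rule splits \<open>Suc m choose i\<close>, and shifting the index in one half
  pairs \<open>f i\<close> with \<open>f (Suc i)\<close>. This peels one finite difference off an
  iterated one.\<close>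

lemma sum_alternating_choose_Suc:
  fixes f :: "nat \<Rightarrow> 'a::comm_ring_1"
  shows "(\<Sum>i\<le>Suc m. (-1) ^ i * of_nat (Suc m choose i) * f i)
       = (\<Sum>i\<le>m. (-1) ^ i * of_nat (m choose i) * (f i - f (Suc i)))"
proof -
  have "(\<Sum>i\<le>Suc m. (-1) ^ i * of_nat (Suc m choose i) * f i)
      = f 0 + (\<Sum>i\<le>m. (-1) ^ Suc i * of_nat (m choose Suc i) * f (Suc i))
        - (\<Sum>i\<le>m. (-1) ^ i * of_nat (m choose i) * f (Suc i))"
    by (subst sum.atMost_Suc_shift) (simp add: algebra_simps sum.distrib sum_negf sum_subtractf)
  also have "f 0 + (\<Sum>i\<le>m. (-1) ^ Suc i * of_nat (m choose Suc i) * f (Suc i))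
      = (\<Sum>i\<le>Suc m. (-1) ^ i * of_nat (m choose i) * f i)"
    by (subst sum.atMost_Suc_shift) simp
  \<comment> \<open>The top term vanishes because \<open>m choose Suc m\<close> is 0.\<close>
  also have "\<dots> = (\<Sum>i\<le>m. (-1) ^ i * of_nat (m choose i) * f i)"
    by (simp add: binomial_eq_0)
  finally show ?thesis
    by (simp add: algebra_simps sum_subtractf)
qed

text \<open>By Pascal's rule, each difference in \<open>i\<close> lowers the lower index of the
  binomial coefficient by one and contributes a sign; after \<open>m\<close> differences only
  \<open>r\<close> is left.\<close>

lemma sum_alternating_choose_mult_choose_add:
  "(\<Sum>i\<le>m. (-1) ^ i * of_nat (m choose i) * of_nat ((x + i) choose (m + r)))
     = (-1) ^ m * (of_nat (x choose r) :: 'a::comm_ring_1)"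
proof (induction m arbitrary: r)
  case 0
  show ?case by simp
next
  case (Suc m)
  have "(\<Sum>i\<le>Suc m. (-1) ^ i * of_nat (Suc m choose i) * of_nat ((x + i) choose (Suc m + r)))
      = (\<Sum>i\<le>m. (-1) ^ i * of_nat (m choose i) * (- of_nat ((x + i) choose (m + r)) :: 'a))"
    by (subst sum_alternating_choose_Suc) (simp add: algebra_simps)
  also have "\<dots> = - (\<Sum>i\<le>m. (-1) ^ i * of_nat (m choose i) * of_nat ((x + i) choose (m + r)))"
    by (simp add: sum_negf)
  finally show ?case
    by (simp add: Suc.IH)
qed

text \<open>With \<open>k = i + j\<close>, trinomial revision moves \<open>n choose j\<close> out of
  the sum, leaving an iterated difference of order \<open>m = n - j\<close>.\<close>

lemma sum_alternating_choose_triple: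
  assumes "j \<le> n"
  shows "(\<Sum>k=j..n. (-1) ^ k * of_nat (n choose k) * of_nat ((n + k) choose k) * of_nat (k choose j))
     = (-1) ^ n * (of_nat (n choose j) * of_nat ((n + j) choose j) :: 'a::comm_ring_1)"
proof -
  obtain m where n: "n = m + j"
    using assms by (metis le_add_diff_inverse2)
  have "(\<Sum>k=j..n. (-1) ^ k * of_nat (n choose k) * of_nat ((n + k) choose k) * of_nat (k choose j))
      = (\<Sum>i\<le>m. (-1) ^ (i + j) * of_nat (n choose (i + j)) * of_nat ((n + (i + j)) choose (i + j))
          * (of_nat ((i + j) choose j) :: 'a))"
    using sum.shift_bounds_cl_nat_ivl[of _ 0 j m] by (simp add: n atMost_atLeast0)
  also have "\<dots> = (\<Sum>i\<le>m. (-1) ^ j * of_nat (n choose j)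
      * ((-1) ^ i * of_nat (m choose i) * of_nat ((n + j + i) choose (m + j))))"
  proof (rule sum.cong[OF refl])
    fix i assume "i \<in> {..m}"
    then have i: "i + j \<le> n" by (simp add: n)
    have 1: "(n choose (i + j)) * ((i + j) choose j) = (n choose j) * (m choose i)"
      using choose_mult[of j "i + j" n] i by (simp add: n)
    \<comment> \<open>Symmetry makes the lower index \<open>m + j = n\<close>, independent of
      \<open>i\<close>, as the difference formula requires.\<close>
    have 2: "(n + (i + j)) choose (i + j) = (n + j + i) choose (m + j)"
      using binomial_symmetric[of "i + j" "n + (i + j)"] by (simp add: n ac_simps)
    have 3: "of_nat (n choose (i + j)) * of_nat ((i + j) choose j)
        = (of_nat (n choose j) * of_nat (m choose i) :: 'a)"
      using 1 by (metis of_nat_mult)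
    have "(-1) ^ (i + j) * of_nat (n choose (i + j)) * of_nat ((n + (i + j)) choose (i + j))
          * of_nat ((i + j) choose j)
        = (-1) ^ (i + j) * of_nat ((n + (i + j)) choose (i + j))
          * (of_nat (n choose (i + j)) * of_nat ((i + j) choose j) :: 'a)"
      by (simp only: mult_ac)
    also have "\<dots> = (-1) ^ j * of_nat (n choose j)
        * ((-1) ^ i * of_nat (m choose i) * of_nat ((n + j + i) choose (m + j)))"
      unfolding 2 3 power_add by (simp only: mult_ac)
    finally show "(-1) ^ (i + j) * of_nat (n choose (i + j)) * of_nat ((n + (i + j)) choose (i + j))
          * (of_nat ((i + j) choose j) :: 'a)
        = (-1) ^ j * of_nat (n choose j)
        * ((-1) ^ i * of_nat (m choose i) * of_nat ((n + j + i) choose (m + j)))" .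
  qed
  \<comment> \<open>The difference formula is applied with \<open>x = n + j\<close> and
    \<open>r = j\<close>.\<close>
  also have "\<dots> = (-1) ^ j * of_nat (n choose j) * ((-1) ^ m * of_nat ((n + j) choose j))"
    unfolding sum_distrib_left[symmetric] sum_alternating_choose_mult_choose_add ..
  finally show ?thesis
    by (simp add: n power_add algebra_simps)
qed

lemma sum_choose_choose_binomial_transform:
  fixes A :: "nat \<Rightarrow> 'a::comm_ring_1"
  shows "(\<Sum>k=0..n. of_nat (n choose k) * of_nat ((n + k) choose k) * (-1) ^ k
            * (\<Sum>j=0..k. of_nat (k choose j) * (-1) ^ j * A j))
       = (-1) ^ n * (\<Sum>j=0..n. of_nat (n choose j) * of_nat ((n + j) choose j) * (-1) ^ j * A j)"
    (is "?L = _")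
proof -
  have "?L = (\<Sum>k=0..n. \<Sum>j=0..k. (-1) ^ j * A j
      * ((-1) ^ k * of_nat (n choose k) * of_nat ((n + k) choose k) * of_nat (k choose j)))"
    by (simp add: sum_distrib_left mult_ac)
  \<comment> \<open>Exchanging the sums over the triangle \<open>j \<le> k \<le> n\<close> isolates
    the coefficient of each \<open>A j\<close>.\<close>
  also have "\<dots> = (\<Sum>j=0..n. \<Sum>k=j..n. (-1) ^ j * A j
      * ((-1) ^ k * of_nat (n choose k) * of_nat ((n + k) choose k) * of_nat (k choose j)))"
    unfolding sum.Sigma[OF finite_atLeastAtMost ballI[OF finite_atLeastAtMost]]
    by (rule sum.reindex_bij_witness[of _ "\<lambda>(j, k). (k, j)" "\<lambda>(k, j). (j, k)"]) auto
  also have "\<dots> = (\<Sum>j=0..n. (-1) ^ j * A j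
      * ((-1) ^ n * (of_nat (n choose j) * of_nat ((n + j) choose j))))"
    unfolding sum_distrib_left[symmetric] by (simp add: sum_alternating_choose_triple)
  finally show ?thesis
    by (simp add: sum_distrib_left mult_ac)
qed

theorem theorem2p3:
  fixes A :: "nat \<Rightarrow> 'a::real_normed_field" and n :: nat
  assumes "(even_sequence A \<and> odd n) \<or> (odd_sequence A \<and> even n)"
  shows "(\<Sum>k=0..n. of_nat (n choose k) * of_nat ((n + k) choose k) * (-1) ^ k * A k) = 0"
    (is "?S = 0")
proof -
  define B where "B k = (\<Sum>j=0..k. of_nat (k choose j) * (-1) ^ j * A j)" for k
  \<comment> \<open>This merges both cases: \<open>B = A\<close> with \<open>n\<close> odd, and
    \<open>B = - A\<close> with \<open>n\<close> even.\<close>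
  have "B = (\<lambda>k. - ((-1) ^ n * A k))"
    using assms by (auto simp: B_def even_sequence_def odd_sequence_def)
  then have "(\<Sum>k=0..n. of_nat (n choose k) * of_nat ((n + k) choose k) * (-1) ^ k * B k)
      = - ((-1) ^ n * ?S)"
    by (simp add: sum_distrib_left sum_negf mult_ac)
  then have "(-1) ^ n * ?S = - ((-1) ^ n * ?S)"
    unfolding B_def sum_choose_choose_binomial_transform .
  \<comment> \<open>A real normed field has characteristic 0, so the factor 2 can be cancelled, as
    can the sign.\<close>
  then have "2 * ((-1) ^ n * ?S) = 0"
    by (simp only: mult_2 eq_neg_iff_add_eq_0)
  then show ?thesis
    by simp
qed

end
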